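(* Let $\mathbb{X}$ be a finite-dimensional Euclidean space, $f:\mathbb{X}\to\mathbb{R}$ continuously differentiable, $P_1,P_2:\mathbb{X}\to\mathbb{R}$ convex, $\sigma>0$, and suppose $\mathcal{F}:=\{x\in\mathbb{X}: P_1(x)-P_2(x)\le\sigma\}$ is nonempty and compact. For $y\in\mathcal{F}$ and $\xi\in\partial P_2(y)$ let $\mathcal{F}(y,\xi):=\{x\in\mathbb{X}: P_1(x)-\langle\xi,x-y\rangle-P_2(y)\le\sigma\}$. Suppose that for every $y\in\mathcal{F}$ and $\xi\in\partial P_2(y)$ there exists $x^\odot_{(y,\xi)}\in\mathbb{X}$ with $P_1(x^\odot_{(y,\xi)})-P_2(y)-\langle\xi,x^\odot_{(y,\xi)}-y\rangle<\sigma$. Define $G:\mathcal{F}\to\mathbb{R}$ by $$G(x)=\inf_{\xi\in\partial P_2(x)}\ \max_{y\in\mathcal{F}(x,\xi)}\langle\nabla f(x),x-y\rangle .$$ Then the following statements hold: (i) $G(x)\ge0$ for all $x\in\mathcal{F}$. (ii) Let $\{x^k\}\subseteq\mathcal{F}$. If $G(x^k)\to0$ and $x^k\to x^*$ for some $x^*$, then $x^*\in\mathcal{F}$ and $x^*$ is a stationary point of the problem $\min\{f(x):x\in\mathcal{F}\}$. (iii) For $x^*\in\mathcal{F}$, we have $G(x^* )=0$ if and only if $x^*$ is a stationary point of $\min\{f(x):x\in\mathcal{F}\}$.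
   Context: $\partial P_i$ is the subdifferential of convex analysis. A point $x^*\in\mathbb{X}$ is called a stationary point of $\min\{f(x): P_1(x)-P_2(x)\le\sigma\}$ if there exists $\lambda_*\ge0$ such that $0\in\nabla f(x^* )+\lambda_*(\partial P_1(x^* )-\partial P_2(x^* ))$, $\lambda_*(P_1(x^* )-P_2(x^* )-\sigma)=0$ and $P_1(x^* )-P_2(x^* )\le\sigma$. *)

theory Defs
  imports "HOL-Analysis.Analysis"
begin

definition subdifferential :: "('a::real_inner \<Rightarrow> real) \<Rightarrow> 'a \<Rightarrow> 'a set" where
  "subdifferential P x = {\<xi>. \<forall>y. P y \<ge> P x + \<xi> \<bullet> (y - x)}"

definition gradient :: "('a::euclidean_space \<Rightarrow> real) \<Rightarrow> 'a \<Rightarrow> 'a" where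
  "gradient f x = (THE g. GDERIV f x :> g)"

lemma GDERIV_gradient:
  fixes f :: "'a::euclidean_space \<Rightarrow> real"
  assumes "f differentiable (at x)"
  shows "GDERIV f x :> gradient f x"
proof -
  obtain f' where f': "(f has_derivative f') (at x)"
    using assms by (auto simp: differentiable_def)
  then interpret bounded_linear f'
    by (rule has_derivative_bounded_linear)
  have "f' = (\<lambda>h. h \<bullet> adjoint f' 1)"
    using adjoint_works[OF linear_axioms, of _ 1] by (simp add: fun_eq_iff)
  then have "GDERIV f x :> adjoint f' 1"
    using f' unfolding gderiv_def by metis
  moreover have "g = g'" if "GDERIV f x :> g" "GDERIV f x :> g'" for g g'
  proof -
    have "(\<lambda>h. h \<bullet> g) = (\<lambda>h. h \<bullet> g')"
      using that unfolding gderiv_def by (rule has_derivative_unique)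
    then have "\<forall>h. h \<bullet> g = h \<bullet> g'"
      unfolding fun_eq_iff .
    then show ?thesis
      by (rule vector_eq_ldot[THEN iffD1])
  qed
  ultimately have "\<exists>!g. GDERIV f x :> g"
    by blast
  then show ?thesis
    unfolding gradient_def by (rule theI')
qed

definition continuously_differentiable :: "('a::euclidean_space \<Rightarrow> real) \<Rightarrow> bool" where
  "continuously_differentiable f \<longleftrightarrow>
     (\<forall>x. f differentiable (at x)) \<and> continuous_on UNIV (gradient f)"

definition feasible_set :: "('a::euclidean_space \<Rightarrow> real) \<Rightarrow> ('a \<Rightarrow> real) \<Rightarrow> real \<Rightarrow> 'a set" where
  "feasible_set P1 P2 \<sigma> = {x. P1 x - P2 x \<le> \<sigma>}"

definition feasible_subset ::
  "('a::euclidean_space \<Rightarrow> real) \<Rightarrow> ('a \<Rightarrow> real) \<Rightarrow> real \<Rightarrow> 'a \<Rightarrow> 'a \<Rightarrow> 'a set" where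
  "feasible_subset P1 P2 \<sigma> y \<xi> = {x. P1 x - \<xi> \<bullet> (x - y) - P2 y \<le> \<sigma>}"

definition stationary_point ::
  "('a::euclidean_space \<Rightarrow> real) \<Rightarrow> ('a \<Rightarrow> real) \<Rightarrow> ('a \<Rightarrow> real) \<Rightarrow> real \<Rightarrow> 'a \<Rightarrow> bool" where
  "stationary_point f P1 P2 \<sigma> x \<longleftrightarrow>
     (\<exists>\<mu>\<ge>0.
        0 \<in> {gradient f x + \<mu> *\<^sub>R (u - v) |u v.
               u \<in> subdifferential P1 x \<and> v \<in> subdifferential P2 x} \<and>
        \<mu> * (P1 x - P2 x - \<sigma>) = 0 \<and>
        P1 x - P2 x \<le> \<sigma>)"

text \<open>
  If \<open>P1\<close>, \<open>P2\<close> are convex, \<open>feasible_set P1 P2 \<sigma>\<close> is compact and \<open>x\<close> lies in it, then for every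
  \<open>\<xi> \<in> subdifferential P2 x\<close> the set \<open>feasible_subset P1 P2 \<sigma> x \<xi>\<close> is a closed subset of
  \<open>feasible_set P1 P2 \<sigma>\<close> containing \<open>x\<close>. So the maximum is attained and nonnegative, and the
  infimum is taken over a nonempty set bounded below.
\<close>

definition merit ::
  "('a::euclidean_space \<Rightarrow> real) \<Rightarrow> ('a \<Rightarrow> real) \<Rightarrow> ('a \<Rightarrow> real) \<Rightarrow> real \<Rightarrow> 'a \<Rightarrow> real" where
  "merit f P1 P2 \<sigma> x =
     (INF \<xi>\<in>subdifferential P2 x.
        GREATEST m. m \<in> (\<lambda>y. gradient f x \<bullet> (x - y)) ` feasible_subset P1 P2 \<sigma> x \<xi>)"

end

theory Submission
  imports Defs
begin

text \<open>
  Fix \<open>x\<close> feasible and \<open>\<xi> \<in> \<partial>P2(x)\<close>. Replacing \<open>P2\<close> by its affine minorant at \<open>x\<close> shrinks the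
  compact feasible set to a compact convex set \<open>F(x, \<xi>)\<close> that still contains \<open>x\<close>, so the linearized
  problem of maximizing \<open>\<nabla>f(x) \<bullet> (x - y)\<close> over \<open>F(x, \<xi>)\<close> has a value that is finite and at least
  \<open>0\<close>; this is (i).

  The value is \<open>0\<close> exactly if \<open>x\<close> itself solves the convex problem of minimizing \<open>\<nabla>f(x) \<bullet> y\<close> over
  \<open>F(x, \<xi>)\<close>. Under the Slater condition this is equivalent to the existence of a Lagrange multiplier
  (\<open>convex_lagrange_multiplier\<close>), and reading off the multiplier inequality as a subgradient
  inequality for \<open>P1\<close> gives the stationarity condition with \<open>\<xi>\<close> as the element of \<open>\<partial>P2(x)\<close>
  (\<open>stationary_point_if_linearized_optimal\<close>). The converse is a direct computation with
  subgradients (\<open>linearized_gap_eq_0_if_multiplier\<close>).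

  For (ii), choose \<open>\<xi>\<^sub>k \<in> \<partial>P2(x\<^sub>k)\<close> almost attaining the infimum in \<open>G(x\<^sub>k)\<close>. Subgradients of a finite
  convex function are locally bounded and have a closed graph, so along a subsequence
  \<open>\<xi>\<^sub>k \<rightarrow> \<xi> \<in> \<partial>P2(x)\<close> (\<open>subdifferential_sequentially_compact\<close>). A point \<open>y\<close> that satisfies the
  constraint of \<open>F(x, \<xi>)\<close> strictly lies in \<open>F(x\<^sub>k, \<xi>\<^sub>k)\<close> for large \<open>k\<close>, so \<open>\<nabla>f(x) \<bullet> (x - y) \<le> 0\<close> in the
  limit. The multiplier rule needs optimality only against such strictly feasible points, hence
  \<open>x\<close> is stationary. The forward direction of (iii) is (ii) for a constant sequence.
\<close>

section \<open>Subgradients and multipliers of convex functions\<close>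

lemma mem_subdifferentialD:
  "\<xi> \<in> subdifferential P x \<Longrightarrow> P x + \<xi> \<bullet> (y - x) \<le> P y"
  by (simp add: subdifferential_def)

lemma continuous_on_if_convex_on_UNIV:
  fixes P :: "'a::euclidean_space \<Rightarrow> real"
  assumes "convex_on UNIV P"
  shows "continuous_on A P"
  using convex_on_continuous[OF open_UNIV assms] continuous_on_subset by blast

text \<open>
  A hyperplane supports the translated strict epigraph of \<open>P\<close> at the origin. It cannot be vertical,
  because the epigraph projects onto the whole space.
\<close>

lemma subdifferential_nonempty:
  fixes P :: "'a::euclidean_space \<Rightarrow> real"
  assumes P: "convex_on UNIV P"
  shows "subdifferential P x \<noteq> {}"
proof -
  define S where "S = {(d, r). P (x + d) - P x < r}"
  have "convex S"
    unfolding convex_def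
  proof (clarsimp simp: S_def)
    fix d r d' r' and u v :: real
    assume *: "P (x + d) - P x < r" "P (x + d') - P x < r'" "0 \<le> u" "0 \<le> v" "u + v = 1"
    have "P (u *\<^sub>R (x + d) + v *\<^sub>R (x + d')) \<le> u * P (x + d) + v * P (x + d')"
      using P * unfolding convex_on_def by blast
    also have "u *\<^sub>R (x + d) + v *\<^sub>R (x + d') = x + (u *\<^sub>R d + v *\<^sub>R d')"
      using \<open>u + v = 1\<close> scaleR_left.add[of u v x] by (simp add: algebra_simps)
    finally have "P (x + (u *\<^sub>R d + v *\<^sub>R d')) \<le> u * P (x + d) + v * P (x + d')" .
    moreover have "u * (P (x + d) - P x) + v * (P (x + d') - P x) < u * r + v * r'"
      using * convex_bound_lt[of "P (x + d) - P x - r" 0 "P (x + d') - P x - r'" u v]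
      by (simp add: algebra_simps)
    moreover have "u * P x + v * P x = P x"
      using \<open>u + v = 1\<close> by (metis distrib_right mult_1)
    ultimately show "P (x + (u *\<^sub>R d + v *\<^sub>R d')) - P x < u * r + v * r'"
      by (simp add: algebra_simps)
  qed
  moreover have "0 \<notin> S"
    by (simp add: S_def zero_prod_def)
  ultimately obtain a b where ab: "(a, b) \<noteq> 0" and sep: "\<forall>p\<in>S. 0 \<le> (a, b) \<bullet> p"
    using separating_hyperplane_set_0 by (metis surj_pair)
  have sep': "0 \<le> a \<bullet> d + b * r" if "P (x + d) - P x < r" for d r
    using sep that by (auto simp: S_def inner_prod_def)
  have "0 \<le> b"
    using sep'[of 0 1] by simp
  moreover have "b \<noteq> 0"
  proof
    assume "b = 0"
    then have "0 \<le> a \<bullet> (- a)"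
      using sep'[of "- a" "P (x - a) - P x + 1"] by simp
    then have "a = 0"
      by (metis inner_minus_right inner_gt_zero_iff neg_0_le_iff_le not_le)
    with \<open>b = 0\<close> ab show False
      by (simp add: zero_prod_def)
  qed
  ultimately have "0 < b" by simp
  have "- (1 / b) *\<^sub>R a \<in> subdifferential P x"
    unfolding subdifferential_def
  proof (clarify)
    fix y
    have "- (a \<bullet> (y - x)) / b \<le> r" if "P y - P x < r" for r
      using sep'[of "y - x" r] that \<open>0 < b\<close> by (simp add: field_simps)
    then have "- (a \<bullet> (y - x)) / b \<le> P y - P x"
      by (rule dense_ge)
    then show "P x + - (1 / b) *\<^sub>R a \<bullet> (y - x) \<le> P y"
      by simp
  qed
  then show ?thesis by blast
qed

text \<open>
  Testing the subgradient inequality at \<open>x + \<xi> / \<bar>\<xi>\<bar>\<close> bounds \<open>\<bar>\<xi>\<bar>\<close> by the oscillation of \<open>P\<close> on the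
  unit ball around \<open>x\<close>.
\<close>

lemma subdifferential_locally_bounded:
  fixes P :: "'a::euclidean_space \<Rightarrow> real"
  assumes P: "convex_on UNIV P" and K: "bounded K"
  shows "bounded (\<Union>x\<in>K. subdifferential P x)"
proof -
  obtain R where R: "\<And>x. x \<in> K \<Longrightarrow> norm x \<le> R"
    using K unfolding bounded_iff by blast
  have "compact (P ` cball 0 (R + 1))"
    by (intro compact_continuous_image continuous_on_if_convex_on_UNIV P compact_cball)
  then obtain M where M: "\<And>y. norm y \<le> R + 1 \<Longrightarrow> \<bar>P y\<bar> \<le> M"
    using compact_imp_bounded[of "P ` cball 0 (R + 1)"]
    unfolding bounded_iff by (metis image_eqI mem_cball_0 real_norm_def)
  have "norm \<xi> \<le> 2 * M" if x: "x \<in> K" and \<xi>: "\<xi> \<in> subdifferential P x" for x \<xi>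
  proof -
    have "norm (x + sgn \<xi>) \<le> R + 1"
      using norm_triangle_ineq[of x "sgn \<xi>"] R[OF x] by (simp add: norm_sgn split: if_splits)
    moreover have "\<xi> \<bullet> sgn \<xi> = norm \<xi>"
      by (cases "\<xi> = 0") (simp_all add: sgn_div_norm dot_square_norm power2_eq_square)
    ultimately show ?thesis
      using mem_subdifferentialD[OF \<xi>, of "x + sgn \<xi>"] M[of "x + sgn \<xi>"] M[of x] R[OF x] by simp
  qed
  then show ?thesis
    unfolding bounded_iff by blast
qed

text \<open>
  Local boundedness yields the convergent subsequence, and the subgradient inequality passes to the
  limit because \<open>P\<close> is continuous.
\<close>

lemma subdifferential_sequentially_compact:
  fixes P :: "'a::euclidean_space \<Rightarrow> real" and X \<Xi> :: "nat \<Rightarrow> 'a"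
  assumes P: "convex_on UNIV P" and X: "X \<longlonglongrightarrow> x"
    and \<Xi>: "\<And>k. \<Xi> k \<in> subdifferential P (X k)"
  obtains \<xi> r where "\<xi> \<in> subdifferential P x" and "strict_mono r" and "(\<Xi> \<circ> r) \<longlonglongrightarrow> \<xi>"
proof -
  have "bounded (range X)"
    using X convergent_imp_bounded by blast
  then have "bounded (\<Union>x\<in>range X. subdifferential P x)"
    by (rule subdifferential_locally_bounded[OF P])
  then have "bounded (range \<Xi>)"
    by (rule bounded_subset) (use \<Xi> in blast)
  then obtain \<xi> r where r: "strict_mono r" and lim: "(\<Xi> \<circ> r) \<longlonglongrightarrow> \<xi>"
    using bounded_imp_convergent_subsequence by blast
  have Xr: "(X \<circ> r) \<longlonglongrightarrow> x"
    using X r by (rule LIMSEQ_subseq_LIMSEQ)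
  have "isCont P x"
    using continuous_on_if_convex_on_UNIV[OF P, of UNIV] by (simp add: continuous_on_eq_continuous_at)
  then have PX: "(\<lambda>k. P ((X \<circ> r) k)) \<longlonglongrightarrow> P x"
    using Xr isCont_tendsto_compose by blast
  have "\<xi> \<in> subdifferential P x"
    unfolding subdifferential_def
  proof (clarify)
    fix y
    have "(\<lambda>k. P ((X \<circ> r) k) + (\<Xi> \<circ> r) k \<bullet> (y - (X \<circ> r) k)) \<longlonglongrightarrow> P x + \<xi> \<bullet> (y - x)"
      by (intro tendsto_intros PX Xr lim)
    then show "P x + \<xi> \<bullet> (y - x) \<le> P y"
      by (rule LIMSEQ_le_const2) (use mem_subdifferentialD[OF \<Xi>] in auto)
  qed
  with r lim show ?thesis
    using that by blast
qed

text \<open>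
  If no \<open>y\<close> makes \<open>\<phi>\<close> and \<open>c\<close> negative at once, the convex set of all pairs that
  strictly dominate some \<open>(\<phi> y, c y)\<close> misses the origin of the plane. A separating line has
  nonnegative coefficients, and the Slater point excludes that \<open>\<phi>\<close> gets coefficient \<open>0\<close>. Since
  both inequalities in the excluded pair are strict, optimality against strictly feasible points
  suffices; the limit argument for stationarity relies on this.
\<close>

lemma convex_lagrange_multiplier:
  fixes \<phi> c :: "'a::real_vector \<Rightarrow> real"
  assumes \<phi>: "convex_on UNIV \<phi>" and c: "convex_on UNIV c"
    and slater: "c z < 0"
    and opt: "\<And>y. c y < 0 \<Longrightarrow> 0 \<le> \<phi> y"
  obtains \<mu> where "0 \<le> \<mu>" and "\<And>y. 0 \<le> \<phi> y + \<mu> * c y"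
proof -
  define S where "S = {(s, t). \<exists>y. \<phi> y < s \<and> c y < t}"
  have "convex S"
    unfolding convex_def
  proof (clarsimp simp: S_def)
    fix s t s' t' y y' and u v :: real
    assume *: "\<phi> y < s" "c y < t" "\<phi> y' < s'" "c y' < t'" "0 \<le> u" "0 \<le> v" "u + v = 1"
    have mix: "h (u *\<^sub>R y + v *\<^sub>R y') < u * p + v * q"
      if "convex_on UNIV h" "h y < p" "h y' < q" for h :: "'a \<Rightarrow> real" and p q
    proof -
      have "h (u *\<^sub>R y + v *\<^sub>R y') \<le> u * h y + v * h y'"
        using that(1) * unfolding convex_on_def by blast
      moreover have "u * h y + v * h y' < u * p + v * q"
        using that(2,3) * convex_bound_lt[of "h y - p" 0 "h y' - q" u v]
        by (simp add: algebra_simps)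
      ultimately show ?thesis by simp
    qed
    show "\<exists>w. \<phi> w < u * s + v * s' \<and> c w < u * t + v * t'"
      using mix[OF \<phi> *(1,3)] mix[OF c *(2,4)] by blast
  qed
  moreover have "0 \<notin> S"
    using opt by (force simp: S_def zero_prod_def)
  ultimately obtain a b where ab: "(a, b) \<noteq> 0" and sep: "\<forall>p\<in>S. 0 \<le> (a, b) \<bullet> p"
    using separating_hyperplane_set_0 by (metis surj_pair)
  have strict: "0 \<le> a * s + b * t" if "\<phi> y < s" "c y < t" for y s t
    using sep that by (auto simp: S_def inner_prod_def)
  have weak: "0 \<le> a * s + b * t" if "\<phi> y \<le> s" "c y \<le> t" for y s t
  proof -
    have "((\<lambda>e. a * (s + e) + b * (t + e)) \<longlongrightarrow> a * (s + 0) + b * (t + 0)) (at_right 0)"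
      by (intro tendsto_intros)
    moreover have "\<forall>\<^sub>F e in at_right 0. 0 \<le> a * (s + e) + b * (t + e)"
      unfolding eventually_at_right_field
      by (rule exI[of _ 1]) (use that in \<open>auto intro!: strict[of y]\<close>)
    ultimately show ?thesis
      using tendsto_lowerbound by fastforce
  qed
  \<comment> \<open>Either coordinate of a pair in \<open>S\<close> may be increased without bound, which a negative coefficient
      would not survive.\<close>
  have coeff: "0 \<le> p" if "\<And>M. 0 \<le> M \<Longrightarrow> 0 \<le> K + p * M" for p K :: real
  proof (rule ccontr)
    assume "\<not> 0 \<le> p"
    then have "0 \<le> (\<bar>K\<bar> + 1) / - p" and "p * ((\<bar>K\<bar> + 1) / - p) = - (\<bar>K\<bar> + 1)"
      by (simp_all add: divide_nonneg_neg field_simps)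
    with that[of "(\<bar>K\<bar> + 1) / - p"] show False by simp
  qed
  have "0 \<le> a"
    by (rule coeff[of "a * \<phi> z + b * c z"])
      (use weak[of z "\<phi> z + _" "c z"] in \<open>simp add: algebra_simps\<close>)
  have "0 \<le> b"
    by (rule coeff[of "a * \<phi> z + b * c z"])
      (use weak[of z "\<phi> z" "c z + _"] in \<open>simp add: algebra_simps\<close>)
  have "a \<noteq> 0"
  proof
    assume "a = 0"
    then have "0 \<le> b * c z" "b \<noteq> 0"
      using weak[of z "\<phi> z" "c z"] ab by (auto simp: zero_prod_def)
    with \<open>0 \<le> b\<close> slater show False
      by (simp add: zero_le_mult_iff)
  qed
  with \<open>0 \<le> a\<close> have "0 < a" by simp
  have "0 \<le> \<phi> y + b / a * c y" for y
    using weak[of y "\<phi> y" "c y"] \<open>0 < a\<close> by (simp add: field_simps)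
  moreover have "0 \<le> b / a"
    using \<open>0 \<le> b\<close> \<open>0 < a\<close> by simp
  ultimately show ?thesis
    using that by blast
qed

section \<open>The linearized subproblem\<close>

definition linearized_gap ::
  "('a::euclidean_space \<Rightarrow> real) \<Rightarrow> ('a \<Rightarrow> real) \<Rightarrow> ('a \<Rightarrow> real) \<Rightarrow> real \<Rightarrow> 'a \<Rightarrow> 'a \<Rightarrow> real" where
  "linearized_gap f P1 P2 \<sigma> x \<xi> =
     (GREATEST m. m \<in> (\<lambda>y. gradient f x \<bullet> (x - y)) ` feasible_subset P1 P2 \<sigma> x \<xi>)"

lemma merit_eq_INF_linearized_gap:
  "merit f P1 P2 \<sigma> x = (INF \<xi>\<in>subdifferential P2 x. linearized_gap f P1 P2 \<sigma> x \<xi>)"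
  by (simp add: merit_def linearized_gap_def)

lemma feasible_subset_subset_feasible_set:
  assumes "\<xi> \<in> subdifferential P2 x"
  shows "feasible_subset P1 P2 \<sigma> x \<xi> \<subseteq> feasible_set P1 P2 \<sigma>"
proof
  fix y
  assume "y \<in> feasible_subset P1 P2 \<sigma> x \<xi>"
  then show "y \<in> feasible_set P1 P2 \<sigma>"
    using mem_subdifferentialD[OF assms, of y] by (simp add: feasible_subset_def feasible_set_def)
qed

lemma base_point_in_feasible_subset:
  "x \<in> feasible_set P1 P2 \<sigma> \<Longrightarrow> x \<in> feasible_subset P1 P2 \<sigma> x \<xi>"
  by (simp add: feasible_subset_def feasible_set_def)

lemma compact_feasible_subset:
  assumes P1: "convex_on UNIV P1" and F: "compact (feasible_set P1 P2 \<sigma>)"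
    and \<xi>: "\<xi> \<in> subdifferential P2 x"
  shows "compact (feasible_subset P1 P2 \<sigma> x \<xi>)"
proof -
  have "closed (feasible_subset P1 P2 \<sigma> x \<xi>)"
    unfolding feasible_subset_def
    by (intro closed_Collect_le continuous_intros continuous_on_if_convex_on_UNIV P1)
  then have "compact (feasible_set P1 P2 \<sigma> \<inter> feasible_subset P1 P2 \<sigma> x \<xi>)"
    using F by (intro compact_Int_closed)
  then show ?thesis
    using feasible_subset_subset_feasible_set[OF \<xi>] by (simp add: Int_absorb1)
qed

text \<open>
  \<open>GREATEST\<close> is meaningful only if a greatest value exists; here it is the maximum of a continuous
  function on a nonempty compact set.
\<close>

lemma linearized_gap_attained:
  assumes P1: "convex_on UNIV P1" and F: "compact (feasible_set P1 P2 \<sigma>)"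
    and x: "x \<in> feasible_set P1 P2 \<sigma>" and \<xi>: "\<xi> \<in> subdifferential P2 x"
  obtains z where "z \<in> feasible_subset P1 P2 \<sigma> x \<xi>"
    and "linearized_gap f P1 P2 \<sigma> x \<xi> = gradient f x \<bullet> (x - z)"
    and "\<And>y. y \<in> feasible_subset P1 P2 \<sigma> x \<xi> \<Longrightarrow>
           gradient f x \<bullet> (x - y) \<le> gradient f x \<bullet> (x - z)"
proof -
  have "feasible_subset P1 P2 \<sigma> x \<xi> \<noteq> {}"
    using base_point_in_feasible_subset[OF x] by blast
  moreover have "continuous_on (feasible_subset P1 P2 \<sigma> x \<xi>) (\<lambda>y. gradient f x \<bullet> (x - y))"
    by (intro continuous_intros)
  ultimately obtain z where z: "z \<in> feasible_subset P1 P2 \<sigma> x \<xi>"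
    and max: "\<forall>y\<in>feasible_subset P1 P2 \<sigma> x \<xi>. gradient f x \<bullet> (x - y) \<le> gradient f x \<bullet> (x - z)"
    using continuous_attains_sup[OF compact_feasible_subset[OF P1 F \<xi>]] by blast
  have "linearized_gap f P1 P2 \<sigma> x \<xi> = gradient f x \<bullet> (x - z)"
    unfolding linearized_gap_def by (rule Greatest_equality) (use z max in auto)
  with z max show ?thesis
    using that by blast
qed

lemma inner_le_linearized_gap:
  assumes "convex_on UNIV P1" and "compact (feasible_set P1 P2 \<sigma>)"
    and "x \<in> feasible_set P1 P2 \<sigma>" and "\<xi> \<in> subdifferential P2 x"
    and "y \<in> feasible_subset P1 P2 \<sigma> x \<xi>"
  shows "gradient f x \<bullet> (x - y) \<le> linearized_gap f P1 P2 \<sigma> x \<xi>"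
  using linearized_gap_attained[OF assms(1-4)] assms(5) by metis

lemma linearized_gap_nonneg:
  assumes "convex_on UNIV P1" and "compact (feasible_set P1 P2 \<sigma>)"
    and "x \<in> feasible_set P1 P2 \<sigma>" and "\<xi> \<in> subdifferential P2 x"
  shows "0 \<le> linearized_gap f P1 P2 \<sigma> x \<xi>"
  using inner_le_linearized_gap[OF assms base_point_in_feasible_subset[OF assms(3)]] by simp

lemma bdd_below_linearized_gap:
  assumes "convex_on UNIV P1" and "compact (feasible_set P1 P2 \<sigma>)"
    and "x \<in> feasible_set P1 P2 \<sigma>"
  shows "bdd_below (linearized_gap f P1 P2 \<sigma> x ` subdifferential P2 x)"
  using linearized_gap_nonneg[OF assms] by (rule bdd_belowI2)

lemma merit_nonneg:
  fixes P1 P2 :: "'a::euclidean_space \<Rightarrow> real"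
  assumes "convex_on UNIV P1" and "convex_on UNIV P2" and "compact (feasible_set P1 P2 \<sigma>)"
    and "x \<in> feasible_set P1 P2 \<sigma>"
  shows "0 \<le> merit f P1 P2 \<sigma> x"
  unfolding merit_eq_INF_linearized_gap
  using subdifferential_nonempty[OF assms(2)] linearized_gap_nonneg[OF assms(1,3,4)]
  by (rule cINF_greatest)

lemma merit_near_optimal_subgradient:
  fixes P1 P2 :: "'a::euclidean_space \<Rightarrow> real"
  assumes "convex_on UNIV P1" and "convex_on UNIV P2" and "compact (feasible_set P1 P2 \<sigma>)"
    and "x \<in> feasible_set P1 P2 \<sigma>" and "0 < e"
  obtains \<xi> where "\<xi> \<in> subdifferential P2 x"
    and "linearized_gap f P1 P2 \<sigma> x \<xi> < merit f P1 P2 \<sigma> x + e"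
proof -
  have "(INF \<xi>\<in>subdifferential P2 x. linearized_gap f P1 P2 \<sigma> x \<xi>) < merit f P1 P2 \<sigma> x + e"
    using assms(5) by (simp add: merit_eq_INF_linearized_gap)
  then show ?thesis
    using that cINF_less_iff[OF subdifferential_nonempty[OF assms(2)]
        bdd_below_linearized_gap[OF assms(1,3,4)]] by blast
qed

section \<open>Stationarity and the linearized subproblem\<close>

text \<open>
  The multiplier rule gives \<open>\<nabla>f(x) \<bullet> (y - x) + \<mu> c(y) \<ge> 0\<close> for all \<open>y\<close>, where \<open>c\<close> is the linearized
  constraint. At \<open>y = x\<close> this is complementarity. For \<open>\<mu> > 0\<close>, dividing by \<open>\<mu>\<close> turns it into the
  subgradient inequality for \<open>\<xi> - \<nabla>f(x) / \<mu> \<in> \<partial>P1(x)\<close>; for \<open>\<mu> = 0\<close> it forces \<open>\<nabla>f(x) = 0\<close>.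
\<close>

lemma stationary_point_if_linearized_optimal:
  fixes f P1 P2 :: "'a::euclidean_space \<Rightarrow> real"
  assumes P1: "convex_on UNIV P1"
    and x: "x \<in> feasible_set P1 P2 \<sigma>" and \<xi>: "\<xi> \<in> subdifferential P2 x"
    and slater: "P1 z - P2 x - \<xi> \<bullet> (z - x) < \<sigma>"
    and opt: "\<And>y. P1 y - P2 x - \<xi> \<bullet> (y - x) < \<sigma> \<Longrightarrow> gradient f x \<bullet> (x - y) \<le> 0"
  shows "stationary_point f P1 P2 \<sigma> x"
proof -
  define g where "g = gradient f x"
  define c where "c = (\<lambda>y. P1 y + (\<xi> \<bullet> x - P2 x - \<sigma> + (- \<xi>) \<bullet> y))"
  have c: "c y = P1 y - P2 x - \<xi> \<bullet> (y - x) - \<sigma>" for y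
    by (simp add: c_def inner_diff_right)
  have affine: "convex_on UNIV (\<lambda>y. k + a \<bullet> y)" for k :: real and a :: 'a
    by (rule convex_onI)
      (auto simp: inner_add_right algebra_simps simp flip: distrib_right)
  have "convex_on UNIV c"
    unfolding c_def by (intro convex_on_add P1 affine)
  moreover have "convex_on UNIV (\<lambda>y. g \<bullet> (y - x))"
    using affine[of "- (g \<bullet> x)" g] by (simp add: inner_diff_right)
  moreover have "c z < 0"
    using slater by (simp add: c)
  moreover have "0 \<le> g \<bullet> (y - x)" if "c y < 0" for y
    using opt[of y] that by (simp add: c g_def inner_diff_right)
  ultimately obtain \<mu> where "0 \<le> \<mu>" and lagrange: "\<And>y. 0 \<le> g \<bullet> (y - x) + \<mu> * c y"
    using convex_lagrange_multiplier[of "\<lambda>y. g \<bullet> (y - x)" c z] by blast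
  have cx: "c x = P1 x - P2 x - \<sigma>" and "c x \<le> 0"
    using x by (simp_all add: c feasible_set_def)
  have compl: "\<mu> * c x = 0"
    using lagrange[of x] \<open>0 \<le> \<mu>\<close> \<open>c x \<le> 0\<close> mult_nonneg_nonpos[of \<mu> "c x"] by simp
  have "\<exists>u\<in>subdifferential P1 x. 0 = g + \<mu> *\<^sub>R (u - \<xi>)"
  proof (cases "\<mu> = 0")
    case True
    have "0 \<le> g \<bullet> ((x - g) - x)"
      using lagrange[of "x - g"] True by simp
    then have "g = 0"
      by (simp add: power2_norm_eq_inner[symmetric])
    then show ?thesis
      using True subdifferential_nonempty[OF P1] by auto
  next
    case False
    with \<open>0 \<le> \<mu>\<close> have "0 < \<mu>" by simp
    have "\<xi> - (1 / \<mu>) *\<^sub>R g \<in> subdifferential P1 x"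
      unfolding subdifferential_def
    proof (clarify)
      fix y
      have "\<mu> * c x \<le> g \<bullet> (y - x) + \<mu> * c y"
        using lagrange[of y] unfolding compl .
      then have "c x \<le> g \<bullet> (y - x) / \<mu> + c y"
        using \<open>0 < \<mu>\<close> by (simp add: field_simps)
      then show "P1 x + (\<xi> - (1 / \<mu>) *\<^sub>R g) \<bullet> (y - x) \<le> P1 y"
        by (simp add: c inner_diff_left)
    qed
    moreover have "0 = g + \<mu> *\<^sub>R ((\<xi> - (1 / \<mu>) *\<^sub>R g) - \<xi>)"
      using \<open>0 < \<mu>\<close> by simp
    ultimately show ?thesis by blast
  qed
  then have "0 \<in> {gradient f x + \<mu> *\<^sub>R (u - v) |u v.
               u \<in> subdifferential P1 x \<and> v \<in> subdifferential P2 x}"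
    using \<xi> unfolding g_def by blast
  then show ?thesis
    unfolding stationary_point_def
    using \<open>0 \<le> \<mu>\<close> compl \<open>c x \<le> 0\<close> by (auto simp: cx)
qed

text \<open>
  Substituting \<open>\<nabla>f(x) = - \<mu> (u - v)\<close> and using the subgradient inequality for \<open>u\<close>, every
  \<open>\<nabla>f(x) \<bullet> (x - y)\<close> is at most \<open>\<mu>\<close> times the increase of the linearized constraint from \<open>x\<close> to \<open>y\<close>,
  and by complementarity this is \<open>\<mu>\<close> times its value at \<open>y\<close>.
\<close>

lemma linearized_gap_eq_0_if_multiplier:
  fixes f P1 P2 :: "'a::euclidean_space \<Rightarrow> real"
  assumes P1: "convex_on UNIV P1" and F: "compact (feasible_set P1 P2 \<sigma>)"
    and x: "x \<in> feasible_set P1 P2 \<sigma>"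
    and u: "u \<in> subdifferential P1 x" and v: "v \<in> subdifferential P2 x"
    and "0 \<le> \<mu>" and zero: "gradient f x + \<mu> *\<^sub>R (u - v) = 0"
    and compl: "\<mu> * (P1 x - P2 x - \<sigma>) = 0"
  shows "linearized_gap f P1 P2 \<sigma> x v = 0"
proof -
  obtain y where y: "y \<in> feasible_subset P1 P2 \<sigma> x v"
    and gap: "linearized_gap f P1 P2 \<sigma> x v = gradient f x \<bullet> (x - y)"
    using linearized_gap_attained[OF P1 F x v] by metis
  have "gradient f x = \<mu> *\<^sub>R (v - u)"
    using zero by (simp add: add_eq_0_iff2 flip: scaleR_minus_right)
  then have "gradient f x \<bullet> (x - y) = \<mu> * (u \<bullet> (y - x) - v \<bullet> (y - x))"
    by (simp only:) (simp add: inner_diff_left inner_diff_right algebra_simps)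
  also have "\<dots> \<le> \<mu> * ((P1 y - P1 x) - v \<bullet> (y - x))"
    using mem_subdifferentialD[OF u, of y] \<open>0 \<le> \<mu>\<close> by (intro mult_left_mono) auto
  also have "\<dots> = \<mu> * (P1 y - v \<bullet> (y - x) - P2 x - \<sigma>)"
    using compl by (simp add: algebra_simps)
  also have "\<dots> \<le> 0"
    using y \<open>0 \<le> \<mu>\<close> by (intro mult_nonneg_nonpos) (auto simp: feasible_subset_def)
  finally show ?thesis
    using gap linearized_gap_nonneg[OF P1 F x v, of f] by simp
qed

lemma merit_eq_0_if_stationary_point:
  fixes f P1 P2 :: "'a::euclidean_space \<Rightarrow> real"
  assumes P1: "convex_on UNIV P1" and P2: "convex_on UNIV P2"
    and F: "compact (feasible_set P1 P2 \<sigma>)" and x: "x \<in> feasible_set P1 P2 \<sigma>"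
    and "stationary_point f P1 P2 \<sigma> x"
  shows "merit f P1 P2 \<sigma> x = 0"
proof -
  obtain \<mu> u v where "0 \<le> \<mu>" "u \<in> subdifferential P1 x" and v: "v \<in> subdifferential P2 x"
    and "gradient f x + \<mu> *\<^sub>R (u - v) = 0" "\<mu> * (P1 x - P2 x - \<sigma>) = 0"
    using assms(5) unfolding stationary_point_def by force
  then have "linearized_gap f P1 P2 \<sigma> x v = 0"
    by (intro linearized_gap_eq_0_if_multiplier[OF P1 F x])
  moreover have "merit f P1 P2 \<sigma> x \<le> linearized_gap f P1 P2 \<sigma> x v"
    unfolding merit_eq_INF_linearized_gap
    by (rule cINF_lower[OF bdd_below_linearized_gap[OF P1 F x] v])
  ultimately show ?thesis
    using merit_nonneg[OF P1 P2 F x, of f] by simp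
qed

text \<open>
  Since \<open>F(X k, \<Xi> k)\<close> varies with \<open>k\<close>, a general point of \<open>F(x, \<xi>)\<close> need not lie in it for any \<open>k\<close>;
  the limit is therefore taken only for points that satisfy the limiting constraint strictly.
\<close>

lemma stationary_point_if_merit_tendsto_0:
  fixes f P1 P2 :: "'a::euclidean_space \<Rightarrow> real" and X :: "nat \<Rightarrow> 'a"
  assumes f: "continuously_differentiable f"
    and P1: "convex_on UNIV P1" and P2: "convex_on UNIV P2"
    and F: "compact (feasible_set P1 P2 \<sigma>)"
    and slater: "\<And>\<xi>. \<xi> \<in> subdifferential P2 x \<Longrightarrow> \<exists>z. P1 z - P2 x - \<xi> \<bullet> (z - x) < \<sigma>"
    and X: "\<And>k. X k \<in> feasible_set P1 P2 \<sigma>" and lim: "X \<longlonglongrightarrow> x"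
    and merit: "(\<lambda>k. merit f P1 P2 \<sigma> (X k)) \<longlonglongrightarrow> 0"
  shows "x \<in> feasible_set P1 P2 \<sigma>" and "stationary_point f P1 P2 \<sigma> x"
proof -
  show x: "x \<in> feasible_set P1 P2 \<sigma>"
    using closed_sequentially[OF compact_imp_closed[OF F] X lim] .
  have "\<exists>\<xi>. \<xi> \<in> subdifferential P2 (X k) \<and>
      linearized_gap f P1 P2 \<sigma> (X k) \<xi> < merit f P1 P2 \<sigma> (X k) + 1 / Suc k" for k
    using merit_near_optimal_subgradient[OF P1 P2 F X, of "1 / Suc k"]
    by (metis of_nat_0_less_iff zero_less_Suc zero_less_divide_1_iff)
  then obtain \<Xi> where \<Xi>: "\<And>k. \<Xi> k \<in> subdifferential P2 (X k)"
    and near: "\<And>k. linearized_gap f P1 P2 \<sigma> (X k) (\<Xi> k) < merit f P1 P2 \<sigma> (X k) + 1 / Suc k"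
    by metis
  obtain \<xi> r where \<xi>: "\<xi> \<in> subdifferential P2 x" and r: "strict_mono r"
    and \<Xi>r: "(\<Xi> \<circ> r) \<longlonglongrightarrow> \<xi>"
    using subdifferential_sequentially_compact[OF P2 lim \<Xi>] .
  have Xr: "(X \<circ> r) \<longlonglongrightarrow> x"
    using lim r by (rule LIMSEQ_subseq_LIMSEQ)
  have "isCont P2 x"
    using continuous_on_if_convex_on_UNIV[OF P2, of UNIV]
    by (simp add: continuous_on_eq_continuous_at)
  then have P2r: "(\<lambda>k. P2 ((X \<circ> r) k)) \<longlonglongrightarrow> P2 x"
    using Xr isCont_tendsto_compose by blast
  have "isCont (gradient f) x"
    using f by (simp add: continuously_differentiable_def continuous_on_eq_continuous_at)
  then have gr: "(\<lambda>k. gradient f ((X \<circ> r) k)) \<longlonglongrightarrow> gradient f x"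
    using Xr isCont_tendsto_compose by blast
  have "(\<lambda>k. merit f P1 P2 \<sigma> (X k) + 1 / Suc k) \<longlonglongrightarrow> 0 + 0"
    by (intro tendsto_add merit lim_1_over_n[THEN LIMSEQ_Suc])
  then have bound: "(\<lambda>k. merit f P1 P2 \<sigma> ((X \<circ> r) k) + 1 / Suc (r k)) \<longlonglongrightarrow> 0"
    using LIMSEQ_subseq_LIMSEQ[OF _ r] by (fastforce simp: comp_def)
  have "gradient f x \<bullet> (x - y) \<le> 0" if y: "P1 y - P2 x - \<xi> \<bullet> (y - x) < \<sigma>" for y
  proof (rule LIMSEQ_le[OF _ bound])
    show "(\<lambda>k. gradient f ((X \<circ> r) k) \<bullet> ((X \<circ> r) k - y)) \<longlonglongrightarrow> gradient f x \<bullet> (x - y)"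
      by (intro tendsto_intros gr Xr)
    have "(\<lambda>k. P1 y - (\<Xi> \<circ> r) k \<bullet> (y - (X \<circ> r) k) - P2 ((X \<circ> r) k))
        \<longlonglongrightarrow> P1 y - \<xi> \<bullet> (y - x) - P2 x"
      by (intro tendsto_intros \<Xi>r Xr P2r)
    \<comment> \<open>Strict feasibility is stable, so \<open>y\<close> competes in the nearby subproblems.\<close>
    then have "\<forall>\<^sub>F k in sequentially. P1 y - (\<Xi> \<circ> r) k \<bullet> (y - (X \<circ> r) k) - P2 ((X \<circ> r) k) < \<sigma>"
      by (rule order_tendstoD) (use y in simp)
    then have "\<forall>\<^sub>F k in sequentially. gradient f ((X \<circ> r) k) \<bullet> ((X \<circ> r) k - y)
        \<le> merit f P1 P2 \<sigma> ((X \<circ> r) k) + 1 / Suc (r k)"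
    proof (rule eventually_mono)
      fix k
      assume "P1 y - (\<Xi> \<circ> r) k \<bullet> (y - (X \<circ> r) k) - P2 ((X \<circ> r) k) < \<sigma>"
      then have "y \<in> feasible_subset P1 P2 \<sigma> (X (r k)) (\<Xi> (r k))"
        by (simp add: feasible_subset_def)
      then have "gradient f (X (r k)) \<bullet> (X (r k) - y) \<le> linearized_gap f P1 P2 \<sigma> (X (r k)) (\<Xi> (r k))"
        by (rule inner_le_linearized_gap[OF P1 F X \<Xi>])
      with near[of "r k"] show "gradient f ((X \<circ> r) k) \<bullet> ((X \<circ> r) k - y)
          \<le> merit f P1 P2 \<sigma> ((X \<circ> r) k) + 1 / Suc (r k)"
        by simp
    qed
    then show "\<exists>N. \<forall>k\<ge>N. gradient f ((X \<circ> r) k) \<bullet> ((X \<circ> r) k - y)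
        \<le> merit f P1 P2 \<sigma> ((X \<circ> r) k) + 1 / Suc (r k)"
      by (simp add: eventually_sequentially)
  qed
  moreover obtain z where "P1 z - P2 x - \<xi> \<bullet> (z - x) < \<sigma>"
    using slater[OF \<xi>] by blast
  ultimately show "stationary_point f P1 P2 \<sigma> x"
    using stationary_point_if_linearized_optimal[OF P1 x \<xi>] by blast
qed

theorem theorem3:
  fixes f P1 P2 :: "'a::euclidean_space \<Rightarrow> real" and \<sigma> :: real
  assumes "continuously_differentiable f"
    and "convex_on UNIV P1" and "convex_on UNIV P2"
    and "\<sigma> > 0"
    and "feasible_set P1 P2 \<sigma> \<noteq> {}" and "compact (feasible_set P1 P2 \<sigma>)"
    and "\<And>y \<xi>. y \<in> feasible_set P1 P2 \<sigma> \<Longrightarrow> \<xi> \<in> subdifferential P2 y \<Longrightarrow>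
           \<exists>x. P1 x - P2 y - \<xi> \<bullet> (x - y) < \<sigma>"
  shows "(\<forall>x \<in> feasible_set P1 P2 \<sigma>. merit f P1 P2 \<sigma> x \<ge> 0) \<and>
    (\<forall>(X :: nat \<Rightarrow> 'a) xs.
       range X \<subseteq> feasible_set P1 P2 \<sigma> \<longrightarrow>
       (\<lambda>k. merit f P1 P2 \<sigma> (X k)) \<longlonglongrightarrow> 0 \<longrightarrow> X \<longlonglongrightarrow> xs \<longrightarrow>
       xs \<in> feasible_set P1 P2 \<sigma> \<and> stationary_point f P1 P2 \<sigma> xs) \<and>
    (\<forall>xs \<in> feasible_set P1 P2 \<sigma>.
       merit f P1 P2 \<sigma> xs = 0 \<longleftrightarrow> stationary_point f P1 P2 \<sigma> xs)"
proof -
  have limit: "xs \<in> feasible_set P1 P2 \<sigma> \<and> stationary_point f P1 P2 \<sigma> xs"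
    if X: "range X \<subseteq> feasible_set P1 P2 \<sigma>" and merit: "(\<lambda>k. merit f P1 P2 \<sigma> (X k)) \<longlonglongrightarrow> 0"
      and lim: "X \<longlonglongrightarrow> xs" for X xs
  proof -
    have Xk: "X k \<in> feasible_set P1 P2 \<sigma>" for k
      using X by blast
    have "xs \<in> feasible_set P1 P2 \<sigma>"
      using closed_sequentially[OF compact_imp_closed[OF assms(6)] Xk lim] .
    then have "\<exists>z. P1 z - P2 xs - \<xi> \<bullet> (z - xs) < \<sigma>" if "\<xi> \<in> subdifferential P2 xs" for \<xi>
      using assms(7) that by blast
    then show ?thesis
      using stationary_point_if_merit_tendsto_0[OF assms(1-3,6) _ Xk lim merit] by blast
  qed
  have "merit f P1 P2 \<sigma> x = 0 \<longleftrightarrow> stationary_point f P1 P2 \<sigma> x"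
    if x: "x \<in> feasible_set P1 P2 \<sigma>" for x
  proof
    assume "merit f P1 P2 \<sigma> x = 0"
    then show "stationary_point f P1 P2 \<sigma> x"
      using limit[of "\<lambda>_. x" x] x by auto
  qed (rule merit_eq_0_if_stationary_point[OF assms(2,3,6) x])
  then show ?thesis
    using merit_nonneg[OF assms(2,3,6)] limit by blast
qed

end
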